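(* Let $G$ be a finite connected undirected weighted graph with $N$ vertices and Laplacian $\mathcal{L}$, whose largest eigenvalue is $\lambda_{N-1}$. Let $g$ be an SGWT kernel and $h$ a scaling function kernel. Given a set of scales $\{t_j\}_{j=1}^J$, $t_j>0$, set $\mathcal{G}(\lambda)=h(\lambda)^2+\sum_{j=1}^J g(t_j\lambda)^2$ and assume that $\mathcal{G}$ attains its minimum and maximum on $[0,\lambda_{N-1}]$ (e.g. $g,h$ continuous). Then the set $$F=\{\phi_n\}_{n=1}^N\cup\{\psi_{t_j,n}\}_{1\le j\le J,\ 1\le n\le N}$$ forms a frame with bounds $A$, $B$ given by $$A=\min_{\lambda\in[0,\lambda_{N-1}]}\mathcal{G}(\lambda),\qquad B=\max_{\lambda\in[0,\lambda_{N-1}]}\mathcal{G}(\lambda).$$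
   Context: A finite weighted undirected graph $G$ on vertices $1,\dots,N$ is given by a symmetric matrix $(a_{m,n})$ with non-negative entries, $a_{m,n}>0$ being the weight of the edge connecting $m$ and $n$ and $a_{m,n}=0$ if there is no such edge (loops are allowed). Functions on the vertices are identified with vectors in $\mathbb{R}^N$. The degree of $m$ is $d(m)=\sum_n a_{m,n}$, and the (non-normalized) graph Laplacian is $\mathcal{L}=\mathrm{diag}(d(1),\dots,d(N))-(a_{m,n})$. Since $\mathcal{L}$ is real symmetric and positive semidefinite and $G$ is connected, fix an orthonormal basis of eigenvectors $\chi_0,\dots,\chi_{N-1}$ with $\mathcal{L}\chi_\ell=\lambda_\ell\chi_\ell$ and $0=\lambda_0<\lambda_1\le\dots\le\lambda_{N-1}$. For a real function $k$ on $[0,\infty)$, $k(\mathcal{L})f=\sum_{\ell}k(\lambda_\ell)\langle\chi_\ell,f\rangle\chi_\ell$. An SGWT kernel is a function $g:[0,\infty)\to[0,\infty)$ with $g(0)=0$ and $\lim_{x\to\infty}g(x)=0$. A scaling function kernel is a function $h:[0,\infty)\to\mathbb{R}$ with $h(0)>0$ and $\lim_{x\to\infty}h(x)=0$. With $\delta_n$ the indicator vector of vertex $n$, the wavelets are $\psi_{t,n}=g(t\mathcal{L})\delta_n$ for $t>0$ and the scaling functions are $\phi_n=h(\mathcal{L})\delta_n$. A family of vectors $\{\Gamma_k\}$ (indexed family, counted with multiplicity) in a Hilbert space $\mathcal{H}$ forms a frame with frame bounds $A$ and $B$ if $A\|f\|^2\le\sum_k|\langle f,\Gamma_k\rangle|^2\le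 B\|f\|^2$ for all $f\in\mathcal{H}$ (no positivity of $A$ is required in this definition); here $\mathcal{H}=\mathbb{R}^N$ with the Euclidean inner product. *)

theory Defs
  imports "HOL-Analysis.Analysis"
begin

text \<open>The vertices are the elements of a finite type \<open>'n\<close>, so \<open>N = CARD('n)\<close>, and
  functions on the vertices are vectors in \<open>real ^ 'n\<close>.\<close>

definition weighted_graph :: "real ^ 'n ^ 'n \<Rightarrow> bool" where
  "weighted_graph a \<longleftrightarrow> (\<forall>m n. a $ m $ n = a $ n $ m) \<and> (\<forall>m n. 0 \<le> a $ m $ n)"

definition edges :: "real ^ 'n ^ 'n \<Rightarrow> ('n \<times> 'n) set" where
  "edges a = {(m, n). a $ m $ n > 0}"

definition connected_graph :: "real ^ 'n ^ 'n \<Rightarrow> bool" where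
  "connected_graph a \<longleftrightarrow> (\<forall>m n. (m, n) \<in> (edges a)\<^sup>*)"

definition vertex_degree :: "real ^ 'n ^ 'n \<Rightarrow> 'n::finite \<Rightarrow> real" where
  "vertex_degree a m = (\<Sum>n\<in>UNIV. a $ m $ n)"

definition laplacian :: "real ^ 'n ^ 'n \<Rightarrow> real ^ 'n ^ ('n::finite)" where
  "laplacian a = (\<chi> m n. if m = n then vertex_degree a m else 0) - a"

text \<open>Only the values at indices below \<open>CARD('n)\<close> matter. For the Laplacian of a connected graph
  the relations \<open>ev 0 = 0\<close> and \<open>0 < ev 1\<close> (if \<open>CARD('n) > 1\<close>) are consequences, so they are not
  imposed; the last eigenvalue \<open>ev (CARD('n) - 1)\<close> is the largest one.\<close>

definition ordered_eigenbasis ::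
  "real ^ 'n ^ 'n \<Rightarrow> (nat \<Rightarrow> real ^ ('n::finite)) \<Rightarrow> (nat \<Rightarrow> real) \<Rightarrow> bool" where
  "ordered_eigenbasis M v ev \<longleftrightarrow>
     (\<forall>i<CARD('n). \<forall>j<CARD('n). v i \<bullet> v j = (if i = j then 1 else 0)) \<and>
     span (v ` {..<CARD('n)}) = UNIV \<and>
     (\<forall>l<CARD('n). M *v v l = ev l *\<^sub>R v l) \<and>
     (\<forall>i j. i \<le> j \<longrightarrow> j < CARD('n) \<longrightarrow> ev i \<le> ev j)"

text \<open>The operator \<open>k(M)\<close>, where \<open>M\<close> has the eigenbasis \<open>v\<close> with eigenvalues \<open>ev\<close>.\<close>

definition spectral_op ::
  "(nat \<Rightarrow> real ^ 'n) \<Rightarrow> (nat \<Rightarrow> real) \<Rightarrow> (real \<Rightarrow> real) \<Rightarrow> real ^ ('n::finite) \<Rightarrow> real ^ 'n" where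
  "spectral_op v ev k f = (\<Sum>l<CARD('n). (k (ev l) * (v l \<bullet> f)) *\<^sub>R v l)"

text \<open>Kernels are functions on \<open>[0, \<infinity>)\<close>; nothing is required of their values at negative
  arguments.\<close>

definition sgwt_kernel :: "(real \<Rightarrow> real) \<Rightarrow> bool" where
  "sgwt_kernel g \<longleftrightarrow> (\<forall>x\<ge>0. 0 \<le> g x) \<and> g 0 = 0 \<and> (g \<longlongrightarrow> 0) at_top"

definition scaling_kernel :: "(real \<Rightarrow> real) \<Rightarrow> bool" where
  "scaling_kernel h \<longleftrightarrow> 0 < h 0 \<and> (h \<longlongrightarrow> 0) at_top"

definition wavelet ::
  "(nat \<Rightarrow> real ^ 'n) \<Rightarrow> (nat \<Rightarrow> real) \<Rightarrow> (real \<Rightarrow> real) \<Rightarrow> real \<Rightarrow> 'n::finite \<Rightarrow> real ^ 'n" where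
  "wavelet v ev g t n = spectral_op v ev (\<lambda>x. g (t * x)) (axis n 1)"

definition scaling_function ::
  "(nat \<Rightarrow> real ^ 'n) \<Rightarrow> (nat \<Rightarrow> real) \<Rightarrow> (real \<Rightarrow> real) \<Rightarrow> 'n::finite \<Rightarrow> real ^ 'n" where
  "scaling_function v ev h n = spectral_op v ev h (axis n 1)"

text \<open>Summability is required explicitly because \<open>infsum\<close> is \<open>0\<close> for non-summable families.\<close>

definition frame_with_bounds ::
  "'i set \<Rightarrow> ('i \<Rightarrow> 'h::{real_inner, complete_space}) \<Rightarrow> real \<Rightarrow> real \<Rightarrow> bool" where
  "frame_with_bounds I \<Gamma> A B \<longleftrightarrow>
     (\<forall>f. (\<lambda>k. \<bar>f \<bullet> \<Gamma> k\<bar>\<^sup>2) summable_on I \<and>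
          A * (norm f)\<^sup>2 \<le> (\<Sum>\<^sub>\<infinity>k\<in>I. \<bar>f \<bullet> \<Gamma> k\<bar>\<^sup>2) \<and>
          (\<Sum>\<^sub>\<infinity>k\<in>I. \<bar>f \<bullet> \<Gamma> k\<bar>\<^sup>2) \<le> B * (norm f)\<^sup>2)"

text \<open>The family of the \<open>\<phi>\<^sub>n\<close> (index \<open>Inl n\<close>) and the \<open>\<psi>\<close> at scale \<open>t j\<close> and vertex \<open>n\<close>
  (index \<open>Inr (j, n)\<close>); indexing by a disjoint sum counts multiplicities.\<close>

definition sgwt_index :: "nat \<Rightarrow> ('n + nat \<times> 'n) set" where
  "sgwt_index J = UNIV <+> ({1..J} \<times> UNIV)"

definition sgwt_family ::
  "(nat \<Rightarrow> real ^ 'n) \<Rightarrow> (nat \<Rightarrow> real) \<Rightarrow> (real \<Rightarrow> real) \<Rightarrow> (real \<Rightarrow> real) \<Rightarrow> (nat \<Rightarrow> real) \<Rightarrow>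
   'n + nat \<times> 'n \<Rightarrow> real ^ ('n::finite)" where
  "sgwt_family v ev h g t k =
     (case k of Inl n \<Rightarrow> scaling_function v ev h n | Inr (j, n) \<Rightarrow> wavelet v ev g (t j) n)"

definition frame_symbol ::
  "(real \<Rightarrow> real) \<Rightarrow> (real \<Rightarrow> real) \<Rightarrow> nat \<Rightarrow> (nat \<Rightarrow> real) \<Rightarrow> real \<Rightarrow> real" where
  "frame_symbol h g J t x = (h x)\<^sup>2 + (\<Sum>j=1..J. (g (t j * x))\<^sup>2)"

end

theory Submission
  imports Defs
begin

text \<open>
  In the eigenbasis every operator \<open>k(L)\<close> is diagonal with real entries \<open>k(\<lambda>\<^sub>l)\<close>, and in
  particular self-adjoint. Hence \<open>\<langle>f, k(L) \<delta>\<^sub>n\<rangle> = (k(L) f)(n)\<close>, and summing the squares over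
  all vertices \<open>n\<close> gives \<open>\<parallel>k(L) f\<parallel>\<^sup>2\<close>, which by Parseval's identity is
  \<open>\<Sum>\<^sub>l k(\<lambda>\<^sub>l)\<^sup>2 \<langle>\<chi>\<^sub>l, f\<rangle>\<^sup>2\<close> (\<open>sum_inner_spectral_op_axis\<close>). Adding up these identities for
  \<open>k = h\<close> and \<open>k(x) = g(t\<^sub>j x)\<close>, the frame sum of \<open>f\<close> becomes
  \<open>\<Sum>\<^sub>l G(\<lambda>\<^sub>l) \<langle>\<chi>\<^sub>l, f\<rangle>\<^sup>2\<close> (\<open>sum_inner_sgwt_family\<close>), whereas
  \<open>\<parallel>f\<parallel>\<^sup>2 = \<Sum>\<^sub>l \<langle>\<chi>\<^sub>l, f\<rangle>\<^sup>2\<close>. The frame sum is thus a sum of the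
  values \<open>G(\<lambda>\<^sub>l)\<close> with non-negative weights adding up to \<open>\<parallel>f\<parallel>\<^sup>2\<close>.

  The frame bounds follow because each \<open>\<lambda>\<^sub>l\<close> lies in \<open>[0, \<lambda>\<^sub>N\<^sub>-\<^sub>1]\<close>. The upper end is the ordering
  of the eigenvalues; the lower end is the positive semidefiniteness of the Laplacian, whose
  quadratic form is \<open>\<onehalf> \<Sum> a\<^sub>m\<^sub>n (x\<^sub>m - x\<^sub>n)\<^sup>2\<close> (\<open>inner_laplacian\<close>).
\<close>

text \<open>The difference of the two sides is orthogonal to every \<open>v i\<close>, hence to their span, which
  contains the difference itself.\<close>

lemma orthonormal_expansion:
  fixes v :: "'i \<Rightarrow> 'a::real_inner"
  assumes fin: "finite I"
    and on: "\<And>i j. i \<in> I \<Longrightarrow> j \<in> I \<Longrightarrow> v i \<bullet> v j = (if i = j then 1 else 0)"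
    and sp: "span (v ` I) = UNIV"
  shows "f = (\<Sum>i\<in>I. (v i \<bullet> f) *\<^sub>R v i)"
proof -
  let ?r = "f - (\<Sum>i\<in>I. (v i \<bullet> f) *\<^sub>R v i)"
  have "orthogonal ?r y" if "y \<in> v ` I" for y
  proof -
    from that obtain j where j: "j \<in> I" "y = v j" by auto
    have "(\<Sum>i\<in>I. (v i \<bullet> f) * (v i \<bullet> v j)) = (\<Sum>i\<in>I. if i = j then v j \<bullet> f else 0)"
      using j on by (intro sum.cong) auto
    also have "\<dots> = v j \<bullet> f"
      using j fin by simp
    finally show ?thesis
      by (simp add: orthogonal_def inner_diff_left inner_sum_left j(2) inner_commute[of f "v j"])
  qed
  then have "orthogonal ?r ?r"
    using orthogonal_to_span[of ?r "v ` I" ?r] sp by auto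
  then show ?thesis by (simp add: orthogonal_self)
qed

lemma norm_orthonormal_sum:
  fixes v :: "'i \<Rightarrow> 'a::real_inner"
  assumes fin: "finite I"
    and on: "\<And>i j. i \<in> I \<Longrightarrow> j \<in> I \<Longrightarrow> v i \<bullet> v j = (if i = j then 1 else 0)"
  shows "(norm (\<Sum>i\<in>I. c i *\<^sub>R v i))\<^sup>2 = (\<Sum>i\<in>I. (c i)\<^sup>2)"
proof -
  have "(norm (\<Sum>i\<in>I. c i *\<^sub>R v i))\<^sup>2 = (\<Sum>i\<in>I. \<Sum>j\<in>I. c i * (c j * (v i \<bullet> v j)))"
    by (simp only: power2_norm_eq_inner inner_sum_left inner_sum_right inner_scaleR_left
        inner_scaleR_right sum_distrib_left) (subst sum.swap, simp add: mult_ac)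
  also have "\<dots> = (\<Sum>i\<in>I. \<Sum>j\<in>I. if i = j then (c i)\<^sup>2 else 0)"
    using on by (intro sum.cong) (auto simp: power2_eq_square)
  also have "\<dots> = (\<Sum>i\<in>I. (c i)\<^sup>2)"
    using fin by simp
  finally show ?thesis .
qed

lemma parseval_eigenbasis:
  fixes v :: "nat \<Rightarrow> real ^ 'n::finite"
  assumes "ordered_eigenbasis M v ev"
  shows "(norm f)\<^sup>2 = (\<Sum>l<CARD('n). (v l \<bullet> f)\<^sup>2)"
proof -
  have "f = (\<Sum>l<CARD('n). (v l \<bullet> f) *\<^sub>R v l)"
    using assms by (intro orthonormal_expansion) (auto simp: ordered_eigenbasis_def)
  then have "(norm f)\<^sup>2 = (norm (\<Sum>l<CARD('n). (v l \<bullet> f) *\<^sub>R v l))\<^sup>2"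
    by simp
  also have "\<dots> = (\<Sum>l<CARD('n). (v l \<bullet> f)\<^sup>2)"
    using assms by (intro norm_orthonormal_sum) (auto simp: ordered_eigenbasis_def)
  finally show ?thesis .
qed

lemma norm_spectral_op:
  fixes v :: "nat \<Rightarrow> real ^ 'n::finite"
  assumes "ordered_eigenbasis M v ev"
  shows "(norm (spectral_op v ev k f))\<^sup>2 = (\<Sum>l<CARD('n). (k (ev l))\<^sup>2 * (v l \<bullet> f)\<^sup>2)"
  unfolding spectral_op_def
  using assms by (subst norm_orthonormal_sum) (auto simp: ordered_eigenbasis_def power_mult_distrib)

lemma inner_spectral_op_commute:
  "f \<bullet> spectral_op v ev k u = spectral_op v ev k f \<bullet> u"
  by (simp add: spectral_op_def inner_sum_left inner_sum_right inner_commute mult_ac)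

lemma sum_inner_spectral_op_axis:
  fixes v :: "nat \<Rightarrow> real ^ 'n::finite"
  assumes "ordered_eigenbasis M v ev"
  shows "(\<Sum>n\<in>UNIV. (f \<bullet> spectral_op v ev k (axis n 1))\<^sup>2)
    = (\<Sum>l<CARD('n). (k (ev l))\<^sup>2 * (v l \<bullet> f)\<^sup>2)"
proof -
  have "(\<Sum>n\<in>UNIV. (f \<bullet> spectral_op v ev k (axis n 1))\<^sup>2)
      = (\<Sum>n\<in>UNIV. (spectral_op v ev k f $ n)\<^sup>2)"
    by (simp add: inner_spectral_op_commute inner_axis)
  also have "\<dots> = (norm (spectral_op v ev k f))\<^sup>2"
    unfolding power2_norm_eq_inner by (simp add: inner_vec_def power2_eq_square)
  finally show ?thesis
    by (simp add: norm_spectral_op[OF assms])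
qed

lemma finite_sgwt_index: "finite (sgwt_index J :: ('n::finite + nat \<times> 'n) set)"
  by (simp add: sgwt_index_def)

text \<open>In the eigenbasis the frame operator is diagonal with entries \<open>G(\<lambda>\<^sub>l)\<close>.\<close>

lemma sum_inner_sgwt_family:
  fixes v :: "nat \<Rightarrow> real ^ 'n::finite"
  assumes "ordered_eigenbasis M v ev"
  shows "(\<Sum>k\<in>sgwt_index J. (f \<bullet> sgwt_family v ev h g t k)\<^sup>2)
    = (\<Sum>l<CARD('n). frame_symbol h g J t (ev l) * (v l \<bullet> f)\<^sup>2)"
proof -
  have "(\<Sum>k\<in>sgwt_index J. (f \<bullet> sgwt_family v ev h g t k)\<^sup>2)
      = (\<Sum>n\<in>UNIV. (f \<bullet> scaling_function v ev h n)\<^sup>2)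
        + (\<Sum>j=1..J. \<Sum>n\<in>UNIV. (f \<bullet> wavelet v ev g (t j) n)\<^sup>2)"
    by (simp add: sgwt_index_def sgwt_family_def sum.Plus sum.cartesian_product split_def)
  also have "\<dots> = (\<Sum>l<CARD('n). (h (ev l))\<^sup>2 * (v l \<bullet> f)\<^sup>2)
        + (\<Sum>j=1..J. \<Sum>l<CARD('n). (g (t j * ev l))\<^sup>2 * (v l \<bullet> f)\<^sup>2)"
    by (simp add: scaling_function_def wavelet_def sum_inner_spectral_op_axis[OF assms])
  also have "\<dots> = (\<Sum>l<CARD('n). frame_symbol h g J t (ev l) * (v l \<bullet> f)\<^sup>2)"
    by (subst sum.swap)
      (simp add: frame_symbol_def sum_distrib_right distrib_right sum.distrib)
  finally show ?thesis .
qed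

text \<open>Symmetry of the weights lets the diagonal part be split evenly between the two ends of each
  edge, which completes the squares.\<close>

lemma inner_laplacian:
  fixes a :: "real ^ 'n ^ 'n::finite"
  assumes "weighted_graph a"
  shows "x \<bullet> (laplacian a *v x) = (\<Sum>m\<in>UNIV. \<Sum>n\<in>UNIV. a $ m $ n * (x $ m - x $ n)\<^sup>2) / 2"
proof -
  define D where "D = (\<Sum>m\<in>UNIV. \<Sum>n\<in>UNIV. a $ m $ n * (x $ m)\<^sup>2)"
  define E where "E = (\<Sum>m\<in>UNIV. \<Sum>n\<in>UNIV. a $ m $ n * (x $ m * x $ n))"
  have D': "(\<Sum>m\<in>UNIV. \<Sum>n\<in>UNIV. a $ m $ n * (x $ n)\<^sup>2) = D"
  proof -
    have "a $ m $ n = a $ n $ m" for m n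
      using assms by (simp add: weighted_graph_def)
    then show ?thesis
      unfolding D_def by (subst sum.swap) (intro sum.cong refl arg_cong2[of _ _ _ _ "(*)"])
  qed
  have "(laplacian a *v x) $ m = vertex_degree a m * x $ m - (\<Sum>n\<in>UNIV. a $ m $ n * x $ n)" for m
    by (simp add: laplacian_def matrix_vector_mult_def left_diff_distrib sum_subtractf
        if_distrib[of "\<lambda>c. c * _"] cong: if_cong)
  then have "x \<bullet> (laplacian a *v x) = D - E"
    by (simp add: inner_vec_def D_def E_def vertex_degree_def right_diff_distrib sum_subtractf
        sum_distrib_left sum_distrib_right power2_eq_square mult_ac)
  moreover have "(\<Sum>m\<in>UNIV. \<Sum>n\<in>UNIV. a $ m $ n * (x $ m - x $ n)\<^sup>2) = D + D - 2 * E"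
  proof -
    have "a $ m $ n * (x $ m - x $ n)\<^sup>2
        = a $ m $ n * (x $ m)\<^sup>2 + a $ m $ n * (x $ n)\<^sup>2 - 2 * (a $ m $ n * (x $ m * x $ n))" for m n
      by (simp add: power2_eq_square algebra_simps)
    then have "(\<Sum>m\<in>UNIV. \<Sum>n\<in>UNIV. a $ m $ n * (x $ m - x $ n)\<^sup>2)
        = D + (\<Sum>m\<in>UNIV. \<Sum>n\<in>UNIV. a $ m $ n * (x $ n)\<^sup>2) - 2 * E"
      by (simp add: D_def E_def sum.distrib sum_subtractf sum_distrib_left)
    with D' show ?thesis by simp
  qed
  ultimately show ?thesis by simp
qed

lemma laplacian_eigenvalue_nonneg:
  fixes a :: "real ^ 'n ^ 'n::finite"
  assumes "weighted_graph a" and "ordered_eigenbasis (laplacian a) v ev" and "l < CARD('n)"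
  shows "0 \<le> ev l"
proof -
  have "ev l = v l \<bullet> (laplacian a *v v l)"
    using assms(2,3) by (simp add: ordered_eigenbasis_def)
  also have "\<dots> \<ge> 0"
    using assms(1) unfolding inner_laplacian[OF assms(1)]
    by (auto simp: weighted_graph_def intro!: sum_nonneg)
  finally show ?thesis .
qed

theorem theorem5p8:
  fixes a :: "real ^ 'n ^ ('n::finite)"
    and v :: "nat \<Rightarrow> real ^ 'n" and ev :: "nat \<Rightarrow> real"
    and g h :: "real \<Rightarrow> real"
    and J :: nat and t :: "nat \<Rightarrow> real"
  defines "S \<equiv> {0..ev (CARD('n) - 1)}"
  assumes "weighted_graph a" and "connected_graph a"
    and "ordered_eigenbasis (laplacian a) v ev"
    and "sgwt_kernel g" and "scaling_kernel h"
    and "\<forall>j\<in>{1..J}. 0 < t j"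
    and "\<exists>x\<in>S. \<forall>y\<in>S. frame_symbol h g J t x \<le> frame_symbol h g J t y"
    and "\<exists>x\<in>S. \<forall>y\<in>S. frame_symbol h g J t y \<le> frame_symbol h g J t x"
  shows "frame_with_bounds (sgwt_index J) (sgwt_family v ev h g t)
           (LEAST y. y \<in> frame_symbol h g J t ` S)
           (GREATEST y. y \<in> frame_symbol h g J t ` S)"
proof -
  let ?G = "frame_symbol h g J t"
  let ?A = "LEAST y. y \<in> ?G ` S" and ?B = "GREATEST y. y \<in> ?G ` S"
  note eb = \<open>ordered_eigenbasis (laplacian a) v ev\<close>
  have ev: "ev l \<in> S" if "l < CARD('n)" for l
  proof -
    have "ev l \<le> ev (CARD('n) - 1)"
      using eb that by (auto simp: ordered_eigenbasis_def)
    with that show ?thesis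
      using laplacian_eigenvalue_nonneg[OF \<open>weighted_graph a\<close> eb] by (simp add: S_def)
  qed
  obtain x where x: "x \<in> S" "\<And>y. y \<in> S \<Longrightarrow> ?G x \<le> ?G y"
    using assms(8) by blast
  obtain z where z: "z \<in> S" "\<And>y. y \<in> S \<Longrightarrow> ?G y \<le> ?G z"
    using assms(9) by blast
  have "?A = ?G x"
    using x by (intro Least_equality) auto
  moreover have "?B = ?G z"
    using z by (intro Greatest_equality) auto
  ultimately have bounds: "?A \<le> ?G (ev l)" "?G (ev l) \<le> ?B" if "l < CARD('n)" for l
    using x z ev[OF that] by auto
  have "?A * (norm f)\<^sup>2 \<le> (\<Sum>l<CARD('n). ?G (ev l) * (v l \<bullet> f)\<^sup>2)" for f
    unfolding parseval_eigenbasis[OF eb] sum_distrib_left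
    using bounds(1) by (intro sum_mono mult_right_mono) auto
  moreover have "(\<Sum>l<CARD('n). ?G (ev l) * (v l \<bullet> f)\<^sup>2) \<le> ?B * (norm f)\<^sup>2" for f
    unfolding parseval_eigenbasis[OF eb] sum_distrib_left
    using bounds(2) by (intro sum_mono mult_right_mono) auto
  ultimately show ?thesis
    by (simp add: frame_with_bounds_def finite_sgwt_index sum_inner_sgwt_family[OF eb]
        summable_on_finite)
qed

end
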